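(* Let $L>0$, let $\mathcal{M}=\{(\dot x_i,x_i,u_i)\}_{i\in I}$, $I=\{1,\dots,T\}$, be a set of measurements with $\dot x_i,x_i\in\mathbb{R}^n$, $u_i\in\mathbb{R}^m$, let $G\in\mathbb{R}^{n\times m}$, and let $Y=[y_1\ \cdots\ y_T]\in\mathbb{R}^{n\times T}$ with $y_i:=\dot x_i-Gu_i$. (a) The pair $(\mathcal{M},G)$ is instantly consistent with a port-Hamiltonian system in the class $\mathcal{H}^+_{L}$ if and only if there exist $A\in\mathbb{R}^{n\times n}$, $g_i\in\mathbb{R}^n$ and $h_i\in\mathbb{R}$ ($i\in I$) such that $$Y=A\,[g_1\ \cdots\ g_T],\qquad A+A^\top\preceq 0,$$ and for all $i,j\in I$ $$h_i-h_j\ \ge\ -\tfrac{L}{4}\|x_i-x_j\|^2+\tfrac12(g_i+g_j)^\top(x_i-x_j)+\tfrac{1}{4L}\|g_i-g_j\|^2. \qquad (\mathrm{S})$$ Moreover, for any triple $(A,\{g_i,h_i\}_{i\in I})$ satisfying all these conditions there exist $J=-J^\top$, $R=R^\top\succeq0$ in $\mathbb{R}^{n\times n}$, $H\in\mathcal{H}^+_{L}$ and $c\in\mathbb{R}$ such that $\dot x_i=(J-R)\nabla H(x_i)+Gu_i$ for all $i\in I$ and $$A=J-R,\qquad \nabla H(x_i)=g_i,\qquad H(x_i)=h_i+c\qquad\text{for all } i\in I.$$ (b) For every $\mu$ with $0\le\mu<L$, the same result (both the equivalence and the "moreover" part) holds with the class $\mathcal{H}^+_{\mu,L}$ in place of $\mathcal{H}^+_{L}$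 and with (S) replaced by the condition that for all $i,j\in I$ $$h_i-h_j\ \ge\ g_j^\top(x_i-x_j)+\frac{1}{2(1-\mu/L)}\Big(\tfrac1L\|g_i-g_j\|^2+\mu\|x_i-x_j\|^2-\tfrac{\mu}{L}(g_j-g_i)^\top(x_j-x_i)\Big).$$
   Context: $\|\cdot\|$ is the Euclidean norm; $\succeq,\preceq$ refer to the positive/negative semidefinite order on symmetric matrices. The points $\dot x_i$, $x_i$ are treated as independent vectors (no relation between $\dot x_i$ and a time derivative is imposed). For $L>0$, $\mathcal{H}_L$ is the set of $H\in C^1(\mathbb{R}^n)$ (real-valued) with $\|\nabla H(x)-\nabla H(y)\|\le L\|x-y\|$ for all $x,y\in\mathbb{R}^n$. For $\mu\ge0$, $\mathcal{H}_{\mu,L}$ is the set of $L$-smooth $\mu$-strongly convex functions, i.e. $H\in\mathcal{H}_L$ with $H(y)\ge H(x)+\nabla H(x)^\top(y-x)+\frac{\mu}{2}\|y-x\|^2$ for all $x,y\in\mathbb{R}^n$. $\mathcal{H}_L^+$ and $\mathcal{H}_{\mu,L}^+$ are the subsets of functions $H$ with $H(x)\ge0$ for all $x\in\mathbb{R}^n$. Definition (instant consistency). Let $\mathcal{H}$ be a class of nonnegative functions on $\mathbb{R}^n$. The pair $(\mathcal{M},G)$ is instantly consistent with a port-Hamiltonian (pH) system in the class $\mathcal{H}$ if there exist constant matrices $J=-J^\top$, $R=R^\top\succeq0$ in $\mathbb{R}^{n\times n}$ and $H\in\mathcal{H}$ such that $\dot x_i=(J-R)\nabla H(x_i)+Gu_i$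 for all $i\in I$.
   Formalization: In (b) the last term of the condition is taken as −(2μ/L)(g_j−g_i)ᵀ(x_j−x_i) instead of −(μ/L)(g_j−g_i)ᵀ(x_j−x_i); with the printed coefficient the "only if" direction fails, e.g. for L=2, μ=1, H(x)=‖x‖², J=R=0 and x_1≠x_2. *)

theory Defs
  imports "HOL-Analysis.Analysis"
begin

text \<open>Only meaningful at points where \<^term>\<open>f\<close> is differentiable.\<close>

definition gradient :: "(real^'n \<Rightarrow> real) \<Rightarrow> real^'n \<Rightarrow> real^'n" where
  "gradient f x = (THE D. GDERIV f x :> D)"

definition pos_semidef :: "real^'n^'n \<Rightarrow> bool" where
  "pos_semidef M \<longleftrightarrow> transpose M = M \<and> (\<forall>v. 0 \<le> v \<bullet> (M *v v))"

definition neg_semidef :: "real^'n^'n \<Rightarrow> bool" where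
  "neg_semidef M \<longleftrightarrow> transpose M = M \<and> (\<forall>v. v \<bullet> (M *v v) \<le> 0)"

definition matrix_of_columns :: "('t \<Rightarrow> real^'n) \<Rightarrow> real^'t^'n" where
  "matrix_of_columns v = (\<chi> k i. v i $ k)"

definition smooth_class :: "real \<Rightarrow> (real^'n \<Rightarrow> real) set" where
  "smooth_class L = {H. (\<forall>x. H differentiable (at x)) \<and> continuous_on UNIV (gradient H) \<and>
     (\<forall>x y. norm (gradient H x - gradient H y) \<le> L * norm (x - y))}"

definition smooth_sconvex_class :: "real \<Rightarrow> real \<Rightarrow> (real^'n \<Rightarrow> real) set" where
  "smooth_sconvex_class \<mu> L = {H \<in> smooth_class L.
     \<forall>x y. H y \<ge> H x + gradient H x \<bullet> (y - x) + \<mu> / 2 * (norm (y - x))\<^sup>2}"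

definition nonneg_part :: "(real^'n \<Rightarrow> real) set \<Rightarrow> (real^'n \<Rightarrow> real) set" where
  "nonneg_part \<H> = {H \<in> \<H>. \<forall>x. 0 \<le> H x}"

text \<open>A measurement set with index set \<open>I = {1,\<dots>,T}\<close> is given by three families
  \<open>xd\<close>, \<open>x\<close>, \<open>u\<close> over a finite (nonempty) index type \<open>'t\<close> with \<open>T = CARD('t)\<close> elements;
  \<open>xd i\<close> is the measured derivative, a vector independent of \<open>x i\<close>.\<close>

definition explains ::
  "('t \<Rightarrow> real^'n) \<Rightarrow> ('t \<Rightarrow> real^'n) \<Rightarrow> ('t \<Rightarrow> real^'m) \<Rightarrow> real^'m^'n \<Rightarrow>
   real^'n^'n \<Rightarrow> real^'n^'n \<Rightarrow> (real^'n \<Rightarrow> real) \<Rightarrow> bool" where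
  "explains xd x u G J R H \<longleftrightarrow> J = - transpose J \<and> pos_semidef R \<and>
     (\<forall>i. xd i = (J - R) *v gradient H (x i) + G *v u i)"

definition instantly_consistent ::
  "(real^'n \<Rightarrow> real) set \<Rightarrow> ('t \<Rightarrow> real^'n) \<Rightarrow> ('t \<Rightarrow> real^'n) \<Rightarrow> ('t \<Rightarrow> real^'m) \<Rightarrow>
   real^'m^'n \<Rightarrow> bool" where
  "instantly_consistent \<H> xd x u G \<longleftrightarrow> (\<exists>J R. \<exists>H\<in>\<H>. explains xd x u G J R H)"

definition smooth_interp ::
  "real \<Rightarrow> ('t \<Rightarrow> real^'n) \<Rightarrow> ('t \<Rightarrow> real^'n) \<Rightarrow> ('t \<Rightarrow> real) \<Rightarrow> bool" where
  "smooth_interp L x g h \<longleftrightarrow> (\<forall>i j.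
     h i - h j \<ge> - (L / 4) * (norm (x i - x j))\<^sup>2 + 1 / 2 * ((g i + g j) \<bullet> (x i - x j))
       + 1 / (4 * L) * (norm (g i - g j))\<^sup>2)"

text \<open>The cross term carries the factor \<open>2 * \<mu> / L\<close>, as in the interpolation theorem for smooth
  strongly convex functions of Taylor, Hendrickx and Glineur. With \<open>\<mu> / L\<close> instead, the condition
  is not necessary: for \<open>\<mu> = 1\<close>, \<open>L = 2\<close> and \<open>x i \<noteq> x j\<close> no \<open>g\<close>, \<open>h\<close> would satisfy it.\<close>

definition sconvex_interp ::
  "real \<Rightarrow> real \<Rightarrow> ('t \<Rightarrow> real^'n) \<Rightarrow> ('t \<Rightarrow> real^'n) \<Rightarrow> ('t \<Rightarrow> real) \<Rightarrow> bool" where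
  "sconvex_interp \<mu> L x g h \<longleftrightarrow> (\<forall>i j.
     h i - h j \<ge> g j \<bullet> (x i - x j)
       + 1 / (2 * (1 - \<mu> / L)) *
         (1 / L * (norm (g i - g j))\<^sup>2 + \<mu> * (norm (x i - x j))\<^sup>2
          - 2 * \<mu> / L * ((g j - g i) \<bullet> (x j - x i))))"

end

theory Submission
  imports Defs
begin

text \<open>The problem splits into linear algebra and interpolation. Every matrix is a skew part
  plus a symmetric part, so \<open>A + transpose A\<close> is negative semidefinite exactly when
  \<open>A = J - R\<close> with \<open>J\<close> skew and \<open>R\<close> positive semidefinite
  (\<open>skew_psd_decomposition\<close>, \<open>neg_semidef_skew_minus_psd\<close>). It remains to
  see when the data \<open>x i\<close>, \<open>g i\<close>, \<open>h i\<close> are points, gradients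
  and values of a function of the class, up to an additive constant that absorbs nonnegativity.

  Subtracting \<mu>/2 |y|^2 turns a function of the class into a convex \<open>F\<close> lying below
  its paraboloids of curvature M = L - \<mu>, and turns the interpolation condition into
  co-coercivity with constant M (\<open>sconvex_interp_iff_shifted\<close>). Co-coercivity is
  necessary by \<open>quadratic_sandwich_imp_cocoercive\<close>. It is sufficient because a Moreau
  envelope over a polytope interpolates the data (\<open>smooth_convex_interpolation\<close>). That
  envelope grows at least like M/4 |y|^2, so after \<mu>/2 |y|^2 is added back the interpolant is
  still bounded below as long as -L \<le> \<mu>.

  Since L-smoothness bounds a function below by paraboloids of curvature -L, the value \<mu> = -L
  gives part (a), and a single argument for -L \<le> \<mu> < L proves both parts.\<close>

section \<open>Gradients and quadratic bounds\<close>

lemma gradient_eqI: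
  fixes f :: "real^'n \<Rightarrow> real"
  assumes "GDERIV f x :> D"
  shows "gradient f x = D"
  unfolding gradient_def
proof (rule the_equality)
  fix D' assume "GDERIV f x :> D'"
  then have "(\<lambda>h. h \<bullet> D') = (\<lambda>h. h \<bullet> D)"
    using assms unfolding gderiv_def by (rule has_derivative_unique)
  then show "D' = D"
    by (metis vector_eq_ldot)
qed (fact assms)

lemma GDERIV_gradient:
  fixes f :: "real^'n \<Rightarrow> real"
  assumes "f differentiable (at x)"
  shows "GDERIV f x :> gradient f x"
proof -
  obtain f' where f': "(f has_derivative f') (at x)"
    using assms unfolding differentiable_def by blast
  then have lin: "linear f'"
    by (rule has_derivative_linear)
  have "f' = (\<lambda>h. h \<bullet> adjoint f' 1)"
    using adjoint_works[OF lin, of _ 1] by (auto simp: fun_eq_iff)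
  then have "GDERIV f x :> adjoint f' 1"
    using f' unfolding gderiv_def by simp
  then show ?thesis
    using gradient_eqI by metis
qed

text \<open>The descent lemma. Along the segment from \<open>x\<close> to \<open>y\<close>, the gap
  between \<open>f\<close> and its quadratic model is nonincreasing by Cauchy-Schwarz and the
  Lipschitz bound.\<close>

lemma lipschitz_gradient_upper_bound:
  fixes f :: "'a::real_inner \<Rightarrow> real"
  assumes f: "\<And>x. GDERIV f x :> g x"
    and lip: "\<And>x y. norm (g x - g y) \<le> L * norm (x - y)"
  shows "f y \<le> f x + g x \<bullet> (y - x) + L / 2 * (norm (y - x))\<^sup>2"
proof -
  define d where "d = y - x"
  define \<phi> where "\<phi> t = f (x + t *\<^sub>R d) - t * (g x \<bullet> d) - L / 2 * t\<^sup>2 * (norm d)\<^sup>2" for t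
  have "\<phi> 1 \<le> \<phi> 0"
  proof (rule DERIV_nonpos_imp_nonincreasing[of 0 1 \<phi>])
    fix t :: real assume t: "0 \<le> t" "t \<le> 1"
    have "((\<lambda>t. x + t *\<^sub>R d) has_derivative (\<lambda>s. s *\<^sub>R d)) (at t)"
      by (auto intro!: derivative_eq_intros)
    then have "((\<lambda>t. f (x + t *\<^sub>R d)) has_derivative (\<lambda>s. (s *\<^sub>R d) \<bullet> g (x + t *\<^sub>R d))) (at t)"
      using f[of "x + t *\<^sub>R d"] unfolding gderiv_def
      by (rule has_derivative_compose)
    then have "((\<lambda>t. f (x + t *\<^sub>R d)) has_real_derivative g (x + t *\<^sub>R d) \<bullet> d) (at t)"
      unfolding has_field_derivative_def
      by (rule has_derivative_eq_rhs) (auto simp: fun_eq_iff inner_commute)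
    then have deriv: "(\<phi> has_real_derivative
        g (x + t *\<^sub>R d) \<bullet> d - g x \<bullet> d - L * t * (norm d)\<^sup>2) (at t)"
      unfolding \<phi>_def by (auto intro!: derivative_eq_intros)
    have "g (x + t *\<^sub>R d) \<bullet> d - g x \<bullet> d = (g (x + t *\<^sub>R d) - g x) \<bullet> d"
      by (simp add: inner_diff_left)
    also have "\<dots> \<le> norm (g (x + t *\<^sub>R d) - g x) * norm d"
      by (rule norm_cauchy_schwarz)
    also have "\<dots> \<le> (L * norm (t *\<^sub>R d)) * norm d"
      using lip[of "x + t *\<^sub>R d" x] by (intro mult_right_mono) auto
    also have "\<dots> = L * t * (norm d)\<^sup>2"
      using t by (simp add: power2_eq_square)
    finally show "\<exists>D. (\<phi> has_real_derivative D) (at t) \<and> D \<le> 0"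
      using deriv by (intro exI conjI) auto
  qed simp
  then show ?thesis
    by (simp add: \<phi>_def d_def)
qed

lemma lipschitz_gradient_lower_bound:
  fixes f :: "'a::real_inner \<Rightarrow> real"
  assumes f: "\<And>x. GDERIV f x :> g x"
    and lip: "\<And>x y. norm (g x - g y) \<le> L * norm (x - y)"
  shows "f y \<ge> f x + g x \<bullet> (y - x) - L / 2 * (norm (y - x))\<^sup>2"
proof -
  have "- f y \<le> - f x + - g x \<bullet> (y - x) + L / 2 * (norm (y - x))\<^sup>2"
  proof (rule lipschitz_gradient_upper_bound)
    show "GDERIV (\<lambda>x. - f x) x :> - g x" for x
      using f by (rule GDERIV_minus)
    show "norm (- g x - - g y) \<le> L * norm (x - y)" for x y
      using lip[of y x] by (simp add: norm_minus_commute)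
  qed
  then show ?thesis
    by simp
qed

text \<open>Compare the tangent at \<open>x\<close>, which lies below \<open>f\<close>, with the
  paraboloid at \<open>y\<close>, which lies above it, at the point \<open>z\<close> where their
  difference is smallest: a gradient step from \<open>y\<close> along
  \<open>p y - p x\<close>.\<close>

lemma quadratic_sandwich_imp_cocoercive:
  fixes f :: "'a::real_inner \<Rightarrow> real"
  assumes M: "M > 0"
    and lower: "\<And>x y. f x + p x \<bullet> (y - x) \<le> f y"
    and upper: "\<And>x y. f y \<le> f x + p x \<bullet> (y - x) + M / 2 * (norm (y - x))\<^sup>2"
  shows "f y \<ge> f x + p x \<bullet> (y - x) + 1 / (2 * M) * (norm (p y - p x))\<^sup>2"
proof -
  define e where "e = p y - p x"
  define z where "z = y - (1 / M) *\<^sub>R e"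
  have "f x + p x \<bullet> (z - x) \<le> f y + p y \<bullet> (z - y) + M / 2 * (norm (z - y))\<^sup>2"
    using lower[of x z] upper[of z y] by linarith
  moreover have "p x \<bullet> (z - x) = p x \<bullet> (y - x) - (1 / M) * (p x \<bullet> e)"
    by (simp add: z_def algebra_simps)
  moreover have "p y \<bullet> (z - y) = - (1 / M) * (p y \<bullet> e)"
    by (simp add: z_def)
  moreover have "M / 2 * (norm (z - y))\<^sup>2 = 1 / (2 * M) * (norm e)\<^sup>2"
    using M by (simp add: z_def power_divide power2_eq_square)
  moreover have "(1 / M) * (p y \<bullet> e) - (1 / M) * (p x \<bullet> e) = 2 * (1 / (2 * M) * (norm e)\<^sup>2)"
    by (simp add: e_def power2_norm_eq_inner inner_diff_left diff_divide_distrib)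
  ultimately have "f y \<ge> f x + p x \<bullet> (y - x) + 1 / (2 * M) * (norm e)\<^sup>2"
    by linarith
  then show ?thesis
    by (simp add: e_def)
qed

text \<open>The first-order remainder is squeezed between 0 and a quadratic. This yields
  differentiability of the interpolant, which is defined by a minimum and not by a formula.\<close>

lemma quadratic_sandwich_imp_GDERIV:
  fixes f :: "'a::real_inner \<Rightarrow> real"
  assumes lower: "\<And>y. f x + D \<bullet> (y - x) \<le> f y"
    and upper: "\<And>y. f y \<le> f x + D \<bullet> (y - x) + M / 2 * (norm (y - x))\<^sup>2"
  shows "GDERIV f x :> D"
  unfolding gderiv_def has_derivative_at
proof (intro conjI)
  show "bounded_linear (\<lambda>h. h \<bullet> D)"
    by (rule bounded_linear_inner_left)
  show "(\<lambda>h. norm (f (x + h) - f x - h \<bullet> D) / norm h) \<midarrow>0\<rightarrow> 0"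
  proof (rule Lim_null_comparison)
    have "norm (norm (f (x + h) - f x - h \<bullet> D) / norm h) \<le> M / 2 * norm h" if "h \<noteq> 0" for h
    proof -
      have "\<bar>f (x + h) - f x - h \<bullet> D\<bar> \<le> M / 2 * norm h * norm h"
        using lower[of "x + h"] upper[of "x + h"]
        by (simp add: inner_commute power2_eq_square)
      then show ?thesis
        using that by (simp add: divide_le_eq)
    qed
    then show "\<forall>\<^sub>F h in at 0. norm (norm (f (x + h) - f x - h \<bullet> D) / norm h) \<le> M / 2 * norm h"
      by (auto simp: eventually_at intro: exI[of _ 1])
    show "(\<lambda>h. M / 2 * norm h) \<midarrow>0\<rightarrow> 0"
      by (auto intro!: tendsto_eq_intros)
  qed
qed

section \<open>Interpolation by a Moreau envelope\<close>

text \<open>The interpolant is the convex hull of the pointwise minimum of the paraboloids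
  \<open>f i + g i \<bullet> (y - x i) + M / 2 * (norm (y - x i))\<^sup>2\<close>, which all have the same curvature. Completing
  squares, the vertices are \<open>x i - g i / M\<close> and the hull is the Moreau envelope
  \<open>y \<mapsto> min {r + M / 2 * (norm (y - q))\<^sup>2 | (q, r) \<in> K}\<close> of a polytope \<open>K\<close>.\<close>

lemma smooth_convex_interpolation:
  fixes x g :: "'t::finite \<Rightarrow> 'a::euclidean_space" and f :: "'t \<Rightarrow> real"
  assumes M: "M > 0"
    and interp: "\<And>i j. f i \<ge> f j + g j \<bullet> (x i - x j) + 1 / (2 * M) * (norm (g i - g j))\<^sup>2"
  obtains F p C where
    "\<And>y z. F y + p y \<bullet> (z - y) \<le> F z"
    "\<And>y z. F z \<le> F y + p y \<bullet> (z - y) + M / 2 * (norm (z - y))\<^sup>2"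
    "\<And>i. F (x i) = f i" "\<And>i. p (x i) = g i"
    "\<And>y. F y \<ge> M / 4 * (norm y)\<^sup>2 - C"
proof -
  \<comment> \<open>The minimiser of the \<open>i\<close>-th paraboloid, paired with its minimum
    value.\<close>
  define zc where "zc i = (x i - (1 / M) *\<^sub>R g i, f i - 1 / (2 * M) * (norm (g i))\<^sup>2)" for i
  define K where "K = convex hull (range zc)"
  define obj where "obj y k = snd k + M / 2 * (norm (y - fst k))\<^sup>2" for y and k :: "'a \<times> real"
  have K: "compact K" "K \<noteq> {}" "convex K"
    by (auto simp: K_def finite_imp_compact_convex_hull)
  have vertex: "zc i \<in> K" for i
    by (simp add: K_def hull_inc)
  have "\<exists>k\<in>K. \<forall>k'\<in>K. obj y k \<le> obj y k'" for y
  proof (rule continuous_attains_inf[OF K(1,2)])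
    show "continuous_on K (obj y)"
      unfolding obj_def by (intro continuous_intros)
  qed
  then obtain k where k: "\<And>y. k y \<in> K" "\<And>y k'. k' \<in> K \<Longrightarrow> obj y (k y) \<le> obj y k'"
    by metis
  define F where "F y = obj y (k y)" for y
  \<comment> \<open>The paraboloid \<open>obj z (k y)\<close>, as a function of \<open>z\<close>,
    lies above \<open>F\<close> and touches it at \<open>y\<close>; \<open>p y\<close> is its
    gradient there.\<close>
  define p where "p y = M *\<^sub>R (y - fst (k y))" for y

  have upper: "F z \<le> F y + p y \<bullet> (z - y) + M / 2 * (norm (z - y))\<^sup>2" for y z
  proof -
    have "F z \<le> obj z (k y)"
      unfolding F_def by (rule k(2)[OF k(1)])
    also have "\<dots> = F y + p y \<bullet> (z - y) + M / 2 * (norm (z - y))\<^sup>2"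
      unfolding F_def p_def obj_def power2_norm_eq_inner
      by (simp add: algebra_simps inner_commute)
    finally show ?thesis .
  qed

  \<comment> \<open>First-order optimality of \<open>k y\<close> on the convex set \<open>K\<close>:
    moving a fraction \<open>t\<close> towards \<open>k'\<close> changes the objective by t(a + tb);
    divide by \<open>t\<close> and let \<open>t\<close> tend to 0.\<close>
  have optimal: "snd k' \<ge> snd (k y) + p y \<bullet> (fst k' - fst (k y))" if "k' \<in> K" for k' y
  proof -
    define d where "d = k' - k y"
    define a where "a = snd d - p y \<bullet> fst d"
    define b where "b = M / 2 * (norm (fst d))\<^sup>2"
    have step: "0 \<le> a + t * b" if t: "0 < t" "t \<le> 1" for t
    proof -
      have "(1 - t) *\<^sub>R k y + t *\<^sub>R k' \<in> K"
        using K(3) k(1) \<open>k' \<in> K\<close> t unfolding convex_alt by simp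
      then have "k y + t *\<^sub>R d \<in> K"
        by (simp add: d_def algebra_simps)
      then have "obj y (k y) \<le> obj y (k y + t *\<^sub>R d)"
        by (rule k(2))
      also have "\<dots> = obj y (k y) + t * (a + t * b)"
        unfolding obj_def a_def b_def p_def power2_norm_eq_inner
        by (simp add: algebra_simps inner_commute)
      finally show ?thesis
        using t by (simp add: zero_le_mult_iff)
    qed
    have "((\<lambda>t. a + t * b) \<longlongrightarrow> a + 0 * b) (at_right 0)"
      by (intro tendsto_intros)
    moreover have "\<forall>\<^sub>F t in at_right 0. 0 \<le> a + t * b"
      unfolding eventually_at_right_field by (rule exI[of _ 1]) (auto intro: step)
    ultimately have "0 \<le> a + 0 * b"
      by (intro tendsto_lowerbound) auto
    then show ?thesis
      by (simp add: a_def d_def)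
  qed

  \<comment> \<open>The increment of \<open>F\<close> splits into a change of the square, handled by
    convexity of the norm squared, and a move within \<open>K\<close>, handled by
    \<open>optimal\<close>.\<close>
  have lower: "F y + p y \<bullet> (z - y) \<le> F z" for y z
  proof -
    define v where "v = y - fst (k y)"
    define w where "w = z - fst (k z)"
    have "0 \<le> M / 2 * (norm (w - v))\<^sup>2"
      using M by simp
    also have "\<dots> = M / 2 * (norm w)\<^sup>2 - M / 2 * (norm v)\<^sup>2 - p y \<bullet> (w - v)"
      unfolding p_def v_def[symmetric] power2_norm_eq_inner
      by (simp add: algebra_simps inner_commute)
    finally have "M / 2 * (norm w)\<^sup>2 \<ge> M / 2 * (norm v)\<^sup>2 + p y \<bullet> (w - v)"
      by simp
    moreover have "p y \<bullet> (z - y) = p y \<bullet> (w - v) + p y \<bullet> (fst (k z) - fst (k y))"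
      by (simp add: v_def w_def inner_diff_right)
    moreover have "F y = snd (k y) + M / 2 * (norm v)\<^sup>2" "F z = snd (k z) + M / 2 * (norm w)\<^sup>2"
      by (simp_all add: F_def obj_def v_def w_def)
    ultimately show ?thesis
      using optimal[OF k(1)[of z], of y] by linarith
  qed

  \<comment> \<open>The place where \<open>interp\<close> enters: it says that each vertex lies in
    the half-space bounded by the hyperplane of slope \<open>g j\<close> through
    \<open>zc j\<close>, and hence so does \<open>K\<close>. The leftover square later forces the
    minimiser at \<open>x j\<close>, and with it the gradient.\<close>
  have value_at: "obj (x j) k' \<ge> f j + M / 2 * (norm (x j - fst k' - (1 / M) *\<^sub>R g j))\<^sup>2"
    if "k' \<in> K" for k' j
  proof -
    let ?S = "{k'. (g j, -1) \<bullet> k' \<le> (g j, -1) \<bullet> zc j}"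
    have "zc i \<in> ?S" for i
    proof -
      have "g j \<bullet> (x i - x j) + 1 / (2 * M) * (norm (g i - g j))\<^sup>2
        = ((g j, -1) \<bullet> zc i - (g j, -1) \<bullet> zc j) + f i - f j"
        using M unfolding zc_def power2_norm_eq_inner
        by (simp add: algebra_simps inner_commute add_divide_distrib diff_divide_distrib)
      then show ?thesis
        using interp[of j i] by simp
    qed
    then have "K \<subseteq> ?S"
      unfolding K_def by (intro hull_minimal convex_halfspace_le) auto
    then have "(g j, -1) \<bullet> k' \<le> (g j, -1) \<bullet> zc j"
      using that by blast
    then have "snd k' \<ge> f j - 1 / (2 * M) * (norm (g j))\<^sup>2 + g j \<bullet> (fst k' - x j + (1 / M) *\<^sub>R g j)"
      by (simp add: zc_def inner_prod_def algebra_simps)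
    moreover have "M / 2 * (norm (x j - fst k' - (1 / M) *\<^sub>R g j))\<^sup>2 =
        M / 2 * (norm (x j - fst k'))\<^sup>2 - 1 / (2 * M) * (norm (g j))\<^sup>2
        + g j \<bullet> (fst k' - x j + (1 / M) *\<^sub>R g j)"
      using M unfolding power2_norm_eq_inner
      by (simp add: field_simps inner_commute inner_diff_left inner_diff_right inner_add_left inner_add_right)
    ultimately show ?thesis
      unfolding obj_def by linarith
  qed

  have vertex_value: "obj (x j) (zc j) = f j" for j
    using M by (simp add: obj_def zc_def power_divide power2_eq_square)

  have value_le: "F (x j) \<le> f j" for j
    unfolding F_def vertex_value[symmetric] by (rule k(2)[OF vertex])
  have F_interp: "F (x j) = f j" for j
  proof (rule antisym[OF value_le])
    have "0 \<le> M / 2 * (norm (x j - fst (k (x j)) - (1 / M) *\<^sub>R g j))\<^sup>2"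
      using M by simp
    then show "f j \<le> F (x j)"
      using value_at[OF k(1), of j "x j"] by (simp add: F_def)
  qed
  have p_interp: "p (x j) = g j" for j
  proof -
    have "M / 2 * (norm (x j - fst (k (x j)) - (1 / M) *\<^sub>R g j))\<^sup>2 \<le> 0"
      using value_at[OF k(1), of j "x j"] value_le[of j] by (simp add: F_def)
    then have "norm (x j - fst (k (x j)) - (1 / M) *\<^sub>R g j) = 0"
      using M by (simp add: mult_le_0_iff)
    then have "x j - fst (k (x j)) = (1 / M) *\<^sub>R g j"
      by simp
    then show ?thesis
      using M by (simp add: p_def)
  qed

  obtain B where B: "\<And>k'. k' \<in> K \<Longrightarrow> norm k' \<le> B"
    using compact_imp_bounded[OF K(1)] unfolding bounded_iff by blast
  \<comment> \<open>The rate M/4 is what the final shift needs: at \<mu> = -L it equals L/2 and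
    exactly offsets \<mu>/2.\<close>
  have coercive: "F y \<ge> M / 4 * (norm y)\<^sup>2 - (B + M / 2 * B\<^sup>2)" for y
  proof -
    define q where "q = fst (k y)"
    have "norm q \<le> B" and r: "norm (snd (k y)) \<le> B"
      using B[OF k(1)[of y]] norm_fst_le[of "fst (k y)" "snd (k y)"]
        norm_snd_le[of "snd (k y)" "fst (k y)"] by (auto simp: q_def)
    then have q: "M / 2 * (norm q)\<^sup>2 \<le> M / 2 * B\<^sup>2"
      using M by (intro mult_left_mono power_mono) auto
    have "0 \<le> M / 4 * (norm (y - 2 *\<^sub>R q))\<^sup>2"
      using M by simp
    also have "\<dots> = M / 2 * (norm (y - q))\<^sup>2 - M / 4 * (norm y)\<^sup>2 + M / 2 * (norm q)\<^sup>2"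
      unfolding power2_norm_eq_inner by (simp add: algebra_simps inner_commute)
    finally show ?thesis
      using q r by (simp add: F_def obj_def q_def)
  qed

  show thesis
    by (rule that[OF lower upper F_interp p_interp coercive])
qed

section \<open>Quadratic shift between the smooth classes and the convex case\<close>

lemma smooth_classD:
  assumes "H \<in> smooth_class L"
  shows "GDERIV H y :> gradient H y"
    and "norm (gradient H y - gradient H z) \<le> L * norm (y - z)"
  using assms by (auto simp: smooth_class_def intro: GDERIV_gradient)

text \<open>Part (a) is the case \<open>\<mu> = - L\<close> of the argument for part (b).\<close>

lemma smooth_class_eq_sconvex: "smooth_class L = smooth_sconvex_class (- L) L"
  using lipschitz_gradient_lower_bound[OF smooth_classD]
  by (fastforce simp: smooth_sconvex_class_def)

text \<open>At \<mu> = -L the prefactor is 1/4, and the cross term contributes half of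
  \<open>(g i - g j) \<bullet> (x i - x j)\<close>, which turns \<open>g j\<close> into the average
  of \<open>g i\<close> and \<open>g j\<close>.\<close>

lemma smooth_interp_eq_sconvex_interp:
  assumes "L > 0"
  shows "smooth_interp L x g h = sconvex_interp (- L) L x g h"
proof -
  have "- (L / 4) * (norm (x i - x j))\<^sup>2 + 1 / 2 * ((g i + g j) \<bullet> (x i - x j))
       + 1 / (4 * L) * (norm (g i - g j))\<^sup>2 =
      g j \<bullet> (x i - x j) + 1 / (2 * (1 - (- L) / L)) *
         (1 / L * (norm (g i - g j))\<^sup>2 + (- L) * (norm (x i - x j))\<^sup>2
          - 2 * (- L) / L * ((g j - g i) \<bullet> (x j - x i)))" for i j
  proof -
    have "(g j - g i) \<bullet> (x j - x i) = (g i - g j) \<bullet> (x i - x j)"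
      by (metis inner_minus_left inner_minus_right minus_diff_eq minus_minus)
    then show ?thesis
      using assms by (simp add: divide_simps inner_add_left) (simp add: algebra_simps)
  qed
  then show ?thesis
    unfolding smooth_interp_def sconvex_interp_def by (metis (no_types, lifting))
qed

text \<open>The two inequalities have the same slack for each pair: \<open>f\<close> and
  \<open>\<gamma>\<close> are the values and gradients left after subtracting \<mu>/2 |y|^2.\<close>

lemma sconvex_interp_iff_shifted:
  fixes x g :: "'t \<Rightarrow> real^'n" and h :: "'t \<Rightarrow> real"
  assumes L: "L > 0" and \<mu>: "\<mu> < L"
  defines "f \<equiv> \<lambda>i. h i - \<mu> / 2 * (norm (x i))\<^sup>2" and "\<gamma> \<equiv> \<lambda>i. g i - \<mu> *\<^sub>R x i"
  shows "sconvex_interp \<mu> L x g h \<longleftrightarrow>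
    (\<forall>i j. f i \<ge> f j + \<gamma> j \<bullet> (x i - x j) + 1 / (2 * (L - \<mu>)) * (norm (\<gamma> i - \<gamma> j))\<^sup>2)"
proof -
  have "g j \<bullet> (x i - x j) + 1 / (2 * (1 - \<mu> / L)) *
         (1 / L * (norm (g i - g j))\<^sup>2 + \<mu> * (norm (x i - x j))\<^sup>2
          - 2 * \<mu> / L * ((g j - g i) \<bullet> (x j - x i))) - (h i - h j) =
      f j + \<gamma> j \<bullet> (x i - x j) + 1 / (2 * (L - \<mu>)) * (norm (\<gamma> i - \<gamma> j))\<^sup>2 - f i" for i j
  proof -
    define d where "d = x i - x j"
    define e where "e = g i - g j"
    have de: "(g j - g i) \<bullet> (x j - x i) = e \<bullet> d"
      unfolding d_def e_def by (metis inner_minus_left inner_minus_right minus_diff_eq minus_minus)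
    have \<gamma>: "\<gamma> i - \<gamma> j = e - \<mu> *\<^sub>R d"
      by (simp add: \<gamma>_def d_def e_def algebra_simps)
    have f: "f j + \<gamma> j \<bullet> d - f i = g j \<bullet> d - (h i - h j) + \<mu> / 2 * (d \<bullet> d)"
      unfolding f_def \<gamma>_def d_def power2_norm_eq_inner
      by (simp add: algebra_simps inner_commute)
    have norm_\<gamma>: "(norm (e - \<mu> *\<^sub>R d))\<^sup>2 = e \<bullet> e - 2 * \<mu> * (e \<bullet> d) + \<mu>\<^sup>2 * (d \<bullet> d)"
      unfolding power2_norm_eq_inner by (simp add: algebra_simps inner_commute power2_eq_square)
    have "1 / (2 * (1 - \<mu> / L)) * (1 / L * (e \<bullet> e) + \<mu> * (d \<bullet> d) - 2 * \<mu> / L * (e \<bullet> d)) =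
        1 / (2 * (L - \<mu>)) * (e \<bullet> e + \<mu> * L * (d \<bullet> d) - 2 * \<mu> * (e \<bullet> d))"
      using L \<mu> by (simp add: divide_simps)
    \<comment> \<open>Uses \<mu> L = \<mu>^2 + \<mu> (L - \<mu>) to complete the square.\<close>
    also have "\<dots> = \<mu> / 2 * (d \<bullet> d)
        + 1 / (2 * (L - \<mu>)) * (e \<bullet> e - 2 * \<mu> * (e \<bullet> d) + \<mu>\<^sup>2 * (d \<bullet> d))"
      using \<mu> by (simp add: divide_simps) (simp add: algebra_simps power2_eq_square)
    finally show ?thesis
      using f unfolding de \<gamma> norm_\<gamma> d_def[symmetric] e_def[symmetric]
      by (simp add: power2_norm_eq_inner)
  qed
  then show ?thesis
    unfolding sconvex_interp_def by (smt (verit))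
qed

text \<open>Necessity: the strong convexity bound and the descent lemma sandwich the shifted
  function with curvature L - \<mu>.\<close>

lemma smooth_sconvex_class_interp:
  fixes H :: "real^'n \<Rightarrow> real"
  assumes L: "L > 0" and \<mu>: "\<mu> < L" and H: "H \<in> smooth_sconvex_class \<mu> L"
  shows "sconvex_interp \<mu> L x (\<lambda>i. gradient H (x i)) (\<lambda>i. H (x i))"
proof -
  define F where "F y = H y - \<mu> / 2 * (norm y)\<^sup>2" for y
  define p where "p y = gradient H y - \<mu> *\<^sub>R y" for y
  have smooth: "H \<in> smooth_class L"
    and low: "\<And>y z. H z \<ge> H y + gradient H y \<bullet> (z - y) + \<mu> / 2 * (norm (z - y))\<^sup>2"
    using H by (auto simp: smooth_sconvex_class_def)
  have up: "H z \<le> H y + gradient H y \<bullet> (z - y) + L / 2 * (norm (z - y))\<^sup>2" for y z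
    using lipschitz_gradient_upper_bound[OF smooth_classD[OF smooth]] .
  have shift: "F z - F y - p y \<bullet> (z - y)
      = H z - H y - gradient H y \<bullet> (z - y) - \<mu> / 2 * (norm (z - y))\<^sup>2" for y z
    unfolding F_def p_def power2_norm_eq_inner by (simp add: algebra_simps inner_commute)
  have "F z \<ge> F y + p y \<bullet> (z - y) + 1 / (2 * (L - \<mu>)) * (norm (p z - p y))\<^sup>2" for y z
  proof (rule quadratic_sandwich_imp_cocoercive)
    show "F y + p y \<bullet> (z - y) \<le> F z" for y z
      using low[of y z] shift[of z y] by linarith
    show "F z \<le> F y + p y \<bullet> (z - y) + (L - \<mu>) / 2 * (norm (z - y))\<^sup>2" for y z
      using up[of z y] shift[of z y] by (simp add: left_diff_distrib diff_divide_distrib)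
  qed (use \<mu> in simp)
  then show ?thesis
    unfolding sconvex_interp_iff_shifted[OF L \<mu>] F_def p_def by blast
qed

text \<open>Sufficiency: interpolate the shifted data, add \<mu>/2 |y|^2 back, and add the
  coercivity constant \<open>C\<close>, which serves as \<open>c\<close> and makes \<open>H\<close>
  nonnegative.\<close>

lemma sconvex_interp_imp_nonneg_interpolant:
  fixes x g :: "'t::finite \<Rightarrow> real^'n"
  assumes L: "L > 0" and \<mu>: "- L \<le> \<mu>" "\<mu> < L" and interp: "sconvex_interp \<mu> L x g h"
  obtains H c where "H \<in> nonneg_part (smooth_sconvex_class \<mu> L)"
    "\<And>i. gradient H (x i) = g i" "\<And>i. H (x i) = h i + c"
proof -
  define M where "M = L - \<mu>"
  have M: "M > 0"
    using \<mu> by (simp add: M_def)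
  obtain F p C where lower: "\<And>y z. F y + p y \<bullet> (z - y) \<le> F z"
    and upper: "\<And>y z. F z \<le> F y + p y \<bullet> (z - y) + M / 2 * (norm (z - y))\<^sup>2"
    and F_interp: "\<And>i. F (x i) = h i - \<mu> / 2 * (norm (x i))\<^sup>2"
    and p_interp: "\<And>i. p (x i) = g i - \<mu> *\<^sub>R x i"
    and coercive: "\<And>y. F y \<ge> M / 4 * (norm y)\<^sup>2 - C"
    using smooth_convex_interpolation[OF M,
        of "\<lambda>i. h i - \<mu> / 2 * (norm (x i))\<^sup>2" "\<lambda>i. g i - \<mu> *\<^sub>R x i" x]
      interp[unfolded sconvex_interp_iff_shifted[OF L \<mu>(2)], folded M_def]
    by blast
  define H where "H y = F y + \<mu> / 2 * (norm y)\<^sup>2 + C" for y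
  define q where "q y = p y + \<mu> *\<^sub>R y" for y
  have GD: "GDERIV H y :> q y" for y
  proof -
    have "GDERIV F y :> p y"
      using lower upper by (rule quadratic_sandwich_imp_GDERIV)
    then show ?thesis
      unfolding H_def q_def gderiv_def power2_norm_eq_inner
      by (auto intro!: derivative_eq_intros simp: fun_eq_iff algebra_simps inner_commute)
  qed
  then have grad: "gradient H = q"
    by (auto intro: gradient_eqI)
  have lip: "norm (q y - q z) \<le> L * norm (y - z)" for y z
  proof -
    define d where "d = y - z"
    define e where "e = p y - p z"
    \<comment> \<open>Sum of the co-coercivity inequalities for the two orders of \<open>y\<close>
      and \<open>z\<close>.\<close>
    have co: "(norm e)\<^sup>2 \<le> M * (e \<bullet> d)"
    proof -
      have "1 / (2 * M) * (norm (p y - p z))\<^sup>2 + 1 / (2 * M) * (norm (p z - p y))\<^sup>2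
          \<le> - (p z \<bullet> (y - z)) - p y \<bullet> (z - y)"
        using quadratic_sandwich_imp_cocoercive[OF M lower upper, of y z]
          quadratic_sandwich_imp_cocoercive[OF M lower upper, of z y] by linarith
      moreover have "- (p z \<bullet> (y - z)) - p y \<bullet> (z - y) = e \<bullet> d"
        by (simp add: d_def e_def algebra_simps)
      ultimately show ?thesis
        using M unfolding norm_minus_commute[of "p z"] e_def[symmetric] by (simp add: field_simps)
    qed
    have ed: "e \<bullet> d \<le> M * (norm d)\<^sup>2"
    proof -
      have "0 \<le> (norm (e - M *\<^sub>R d))\<^sup>2"
        by simp
      also have "\<dots> = (norm e)\<^sup>2 - 2 * M * (e \<bullet> d) + M * (M * (norm d)\<^sup>2)"
        unfolding power2_norm_eq_inner by (simp add: algebra_simps inner_commute)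
      finally have "M * (e \<bullet> d) \<le> M * (M * (norm d)\<^sup>2)"
        using co by simp
      then show ?thesis
        using M by simp
    qed
    have "(norm (q y - q z))\<^sup>2 = (norm (e + \<mu> *\<^sub>R d))\<^sup>2"
      by (simp add: q_def e_def d_def algebra_simps)
    also have "\<dots> = (norm e)\<^sup>2 + 2 * \<mu> * (e \<bullet> d) + \<mu>\<^sup>2 * (norm d)\<^sup>2"
      unfolding power2_norm_eq_inner by (simp add: algebra_simps inner_commute power2_eq_square)
    \<comment> \<open>For negative \<mu> the triangle inequality would only give the constant L -
      2\<mu>. Instead, \<open>co\<close> reduces everything to a multiple of
      \<open>e \<bullet> d\<close> with coefficient L + \<mu> \<ge> 0, and then (L + \<mu>)(L -
      \<mu>) + \<mu>^2 = L^2.\<close>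
    also have "\<dots> \<le> (L + \<mu>) * (e \<bullet> d) + \<mu>\<^sup>2 * (norm d)\<^sup>2"
      using co by (simp add: M_def algebra_simps)
    also have "\<dots> \<le> (L + \<mu>) * (M * (norm d)\<^sup>2) + \<mu>\<^sup>2 * (norm d)\<^sup>2"
      using ed \<mu> by (intro add_mono mult_left_mono) auto
    also have "\<dots> = (L * norm d)\<^sup>2"
      by (simp add: M_def algebra_simps power2_eq_square)
    finally show ?thesis
      unfolding d_def by (rule power2_le_imp_le) (use L in simp)
  qed
  have "continuous_on UNIV q"
  proof (rule lipschitz_on_continuous_on)
    show "L-lipschitz_on UNIV q"
      using lip L by (auto intro!: lipschitz_onI simp: dist_norm)
  qed
  then have "H \<in> smooth_class L"
    using lip GD by (auto simp: smooth_class_def grad gderiv_def intro: differentiableI)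
  moreover have "H z \<ge> H y + gradient H y \<bullet> (z - y) + \<mu> / 2 * (norm (z - y))\<^sup>2" for y z
  proof -
    have "H z - H y - q y \<bullet> (z - y) - \<mu> / 2 * (norm (z - y))\<^sup>2 = F z - F y - p y \<bullet> (z - y)"
      unfolding H_def q_def power2_norm_eq_inner by (simp add: algebra_simps inner_commute)
    then show ?thesis
      using lower[of y z] unfolding grad by linarith
  qed
  moreover have "0 \<le> H y" for y
  proof -
    have "0 \<le> (L + \<mu>) / 4 * (norm y)\<^sup>2"
      using \<mu> by simp
    also have "\<dots> = M / 4 * (norm y)\<^sup>2 + \<mu> / 2 * (norm y)\<^sup>2"
      by (simp add: M_def field_simps)
    also have "\<dots> \<le> H y"
      using coercive[of y] by (simp add: H_def)
    finally show ?thesis .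
  qed
  ultimately have "H \<in> nonneg_part (smooth_sconvex_class \<mu> L)"
    by (auto simp: nonneg_part_def smooth_sconvex_class_def)
  then show thesis
    by (rule that) (auto simp: grad q_def p_interp H_def F_interp)
qed

section \<open>Skew and semidefinite parts of a matrix\<close>

lemma eq_mult_matrix_of_columns_iff:
  "matrix_of_columns y = A ** matrix_of_columns g \<longleftrightarrow> (\<forall>i. y i = A *v g i)"
  by (auto simp: matrix_of_columns_def vec_eq_iff matrix_matrix_mult_def matrix_vector_mult_def)

lemma semidef_scaleR_neg:
  fixes M :: "real^'n^'n"
  assumes "c < 0"
  shows "pos_semidef (c *\<^sub>R M) \<longleftrightarrow> neg_semidef M" and "neg_semidef (c *\<^sub>R M) \<longleftrightarrow> pos_semidef M"
proof -
  have "v \<bullet> ((c *\<^sub>R M) *v v) = c * (v \<bullet> (M *v v))" for v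
    by (simp add: scaleR_matrix_vector_assoc[symmetric])
  moreover have "transpose (c *\<^sub>R M) = c *\<^sub>R M \<longleftrightarrow> transpose M = M"
    using assms by (simp add: transpose_def vec_eq_iff)
  ultimately show "pos_semidef (c *\<^sub>R M) \<longleftrightarrow> neg_semidef M" "neg_semidef (c *\<^sub>R M) \<longleftrightarrow> pos_semidef M"
    using assms by (auto simp: pos_semidef_def neg_semidef_def zero_le_mult_iff mult_le_0_iff)
qed

lemma skew_psd_decomposition:
  fixes A :: "real^'n^'n"
  assumes "neg_semidef (A + transpose A)"
  obtains J R where "A = J - R" "J = - transpose J" "pos_semidef R"
proof
  define J R where "J = (1 / 2) *\<^sub>R (A - transpose A)" and "R = (- 1 / 2) *\<^sub>R (A + transpose A)"
  show "A = J - R"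
    by (simp add: J_def R_def vec_eq_iff field_simps)
  show "J = - transpose J"
    by (simp add: J_def vec_eq_iff transpose_def field_simps)
  show "pos_semidef R"
    using assms unfolding R_def by (subst semidef_scaleR_neg) auto
qed

lemma neg_semidef_skew_minus_psd:
  fixes J R :: "real^'n^'n"
  assumes J: "J = - transpose J" and R: "pos_semidef R"
  shows "neg_semidef ((J - R) + transpose (J - R))"
proof -
  have "transpose (J - R) = transpose J - transpose R"
    by (simp add: transpose_def vec_eq_iff)
  also have "\<dots> = - J - R"
    using J R by (metis minus_minus pos_semidef_def)
  finally have eq: "(J - R) + transpose (J - R) = (-2) *\<^sub>R R"
    by (simp add: scaleR_2)
  show ?thesis
    using R unfolding eq by (subst semidef_scaleR_neg) auto
qed

section \<open>Consistency with a port-Hamiltonian system\<close>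

text \<open>Common form of parts (a) and (b). The realisation of a feasible triple is proved first,
  because it also gives one direction of the equivalence.\<close>

lemma instantly_consistent_smooth_sconvex_iff:
  fixes xd x :: "'t::finite \<Rightarrow> real^'n" and u :: "'t \<Rightarrow> real^'m" and G :: "real^'m^'n"
  assumes L: "L > 0" and \<mu>: "- L \<le> \<mu>" "\<mu> < L"
    and Y: "Y = matrix_of_columns (\<lambda>i. xd i - G *v u i)"
  defines "feasible \<equiv> \<lambda>(A :: real^'n^'n) g h.
    Y = A ** matrix_of_columns g \<and> neg_semidef (A + transpose A) \<and> sconvex_interp \<mu> L x g h"
  shows "instantly_consistent (nonneg_part (smooth_sconvex_class \<mu> L)) xd x u G \<longleftrightarrow>
      (\<exists>A g h. feasible A g h)" (is ?equiv)
    and "feasible A g h \<Longrightarrow> \<exists>J R. \<exists>H \<in> nonneg_part (smooth_sconvex_class \<mu> L). \<exists>c.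
      explains xd x u G J R H \<and> A = J - R \<and> (\<forall>i. gradient H (x i) = g i \<and> H (x i) = h i + c)"
proof -
  show realise: "\<exists>J R. \<exists>H \<in> nonneg_part (smooth_sconvex_class \<mu> L). \<exists>c.
      explains xd x u G J R H \<and> A = J - R \<and> (\<forall>i. gradient H (x i) = g i \<and> H (x i) = h i + c)"
    if feas: "feasible A g h" for A g h
  proof -
    obtain J R where JR: "A = J - R" "J = - transpose J" "pos_semidef R"
      using feas skew_psd_decomposition unfolding feasible_def by blast
    obtain H c where H: "H \<in> nonneg_part (smooth_sconvex_class \<mu> L)"
      "\<And>i. gradient H (x i) = g i" "\<And>i. H (x i) = h i + c"
      using feas sconvex_interp_imp_nonneg_interpolant[OF L \<mu>] unfolding feasible_def by blast
    have "xd i - G *v u i = A *v g i" for i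
      using feas unfolding feasible_def Y eq_mult_matrix_of_columns_iff by blast
    then have "xd i = (J - R) *v gradient H (x i) + G *v u i" for i
      using JR(1) H(2) by (metis diff_add_cancel)
    then show ?thesis
      using JR H unfolding explains_def by blast
  qed
  show ?equiv
  proof
    assume "instantly_consistent (nonneg_part (smooth_sconvex_class \<mu> L)) xd x u G"
    then obtain J R H where H: "H \<in> smooth_sconvex_class \<mu> L"
      and ex: "explains xd x u G J R H"
      unfolding instantly_consistent_def nonneg_part_def by blast
    have "xd i - G *v u i = (J - R) *v gradient H (x i)" for i
      using ex unfolding explains_def by (metis add_diff_cancel_right')
    then have "feasible (J - R) (\<lambda>i. gradient H (x i)) (\<lambda>i. H (x i))"
      using ex smooth_sconvex_class_interp[OF L \<mu>(2) H] neg_semidef_skew_minus_psd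
      unfolding feasible_def Y eq_mult_matrix_of_columns_iff explains_def by blast
    then show "\<exists>A g h. feasible A g h"
      by blast
  next
    assume "\<exists>A g h. feasible A g h"
    then show "instantly_consistent (nonneg_part (smooth_sconvex_class \<mu> L)) xd x u G"
      using realise unfolding instantly_consistent_def by blast
  qed
qed

theorem theorem1:
  fixes L :: real
    and xd x :: "'t::finite \<Rightarrow> real^'n"
    and u :: "'t \<Rightarrow> real^'m"
    and G :: "real^'m^'n"
    and Y :: "real^'t^'n"
  assumes L_pos: "L > 0"
    and Y_def: "Y = matrix_of_columns (\<lambda>i. xd i - G *v u i)"
  shows
    "((instantly_consistent (nonneg_part (smooth_class L)) xd x u G \<longleftrightarrow>
        (\<exists>(A :: real^'n^'n) g h. Y = A ** matrix_of_columns g \<and> neg_semidef (A + transpose A) \<and>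
           smooth_interp L x g h))
      \<and> (\<forall>(A :: real^'n^'n) g h. Y = A ** matrix_of_columns g \<and> neg_semidef (A + transpose A) \<and>
           smooth_interp L x g h \<longrightarrow>
           (\<exists>J R. \<exists>H \<in> nonneg_part (smooth_class L). \<exists>c.
              explains xd x u G J R H \<and> A = J - R \<and>
              (\<forall>i. gradient H (x i) = g i \<and> H (x i) = h i + c))))
     \<and>
     (\<forall>\<mu>. 0 \<le> \<mu> \<and> \<mu> < L \<longrightarrow>
      (instantly_consistent (nonneg_part (smooth_sconvex_class \<mu> L)) xd x u G \<longleftrightarrow>
        (\<exists>(A :: real^'n^'n) g h. Y = A ** matrix_of_columns g \<and> neg_semidef (A + transpose A) \<and>
           sconvex_interp \<mu> L x g h))
      \<and> (\<forall>(A :: real^'n^'n) g h. Y = A ** matrix_of_columns g \<and> neg_semidef (A + transpose A) \<and>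
           sconvex_interp \<mu> L x g h \<longrightarrow>
           (\<exists>J R. \<exists>H \<in> nonneg_part (smooth_sconvex_class \<mu> L). \<exists>c.
              explains xd x u G J R H \<and> A = J - R \<and>
              (\<forall>i. gradient H (x i) = g i \<and> H (x i) = h i + c))))"
proof (intro conjI[OF _ allI[OF impI]], goal_cases)
  case 1
  have "- L \<le> - L" "- L < L"
    using L_pos by auto
  note result = instantly_consistent_smooth_sconvex_iff[OF L_pos this Y_def, where x = x]
  show ?case
    unfolding smooth_class_eq_sconvex smooth_interp_eq_sconvex_interp[OF L_pos]
    by (intro conjI allI impI) (rule result(1), erule result(2))
next
  case (2 \<mu>)
  then have "- L \<le> \<mu>" "\<mu> < L"
    using L_pos by auto
  note result = instantly_consistent_smooth_sconvex_iff[OF L_pos this Y_def, where x = x]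
  show ?case
    by (intro conjI allI impI) (rule result(1), erule result(2))
qed

end
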